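(* Let $G=(N,S,C)$ be a finite normal form game that is a coset weighted potential game with fixed coset-depending weights $w_i(s_{-i})>0$. Then $G$ possesses at least one pure Nash equilibrium.
   Context: A finite normal form game has players $N=\{1,\dots,n\}$, finite nonempty strategy sets $S_i=\{1,\dots,k_i\}$, $S=\prod_i S_i$, $S_{-i}=\prod_{j\ne i}S_j$, payoffs $c_i:S\to\mathbb{R}$. $G$ is a coset weighted potential game with weights $w_i:S_{-i}\to(0,\infty)$ if there is $P:S\to\mathbb{R}$ such that $c_i(x,s_{-i})-c_i(y,s_{-i})=w_i(s_{-i})(P(x,s_{-i})-P(y,s_{-i}))$ for all $i\in N$, $x,y\in S_i$, $s_{-i}\in S_{-i}$. A pure Nash equilibrium is a profile $s^*\in S$ with $c_i(s^* )\ge c_i(x,s^*_{-i})$ for all $i\in N$ and $x\in S_i$. *)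

theory Defs
  imports Complex_Main "HOL-Library.FuncSet"
begin

text \<open>
  A game is given by the number of players \<open>n\<close>, the numbers of strategies \<open>k i\<close> and the
  payoffs \<open>c i\<close>.  Profiles are extensional functions (elements of \<open>PiE\<close>), so that \<open>S\<close> and
  \<open>S\<^sub>-\<^sub>i\<close> are the literal Cartesian products; only the values of payoffs, weights and potentials
  on these products matter.
\<close>

type_synonym profile = "nat \<Rightarrow> nat"

definition players :: "nat \<Rightarrow> nat set" where
  "players n = {1..n}"

definition strategies :: "(nat \<Rightarrow> nat) \<Rightarrow> nat \<Rightarrow> nat set" where
  "strategies k i = {1..k i}"

definition finite_game :: "nat \<Rightarrow> (nat \<Rightarrow> nat) \<Rightarrow> bool" where
  "finite_game n k \<longleftrightarrow> (\<forall>i\<in>players n. strategies k i \<noteq> {})"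

definition profiles :: "nat \<Rightarrow> (nat \<Rightarrow> nat) \<Rightarrow> profile set" where
  "profiles n k = (\<Pi>\<^sub>E j\<in>players n. strategies k j)"

definition opp_profiles :: "nat \<Rightarrow> (nat \<Rightarrow> nat) \<Rightarrow> nat \<Rightarrow> profile set" where
  "opp_profiles n k i = (\<Pi>\<^sub>E j\<in>players n - {i}. strategies k j)"

text \<open>The component \<open>s\<^sub>-\<^sub>i\<close> of a profile \<open>s\<close>, and the profile \<open>(x, s\<^sub>-\<^sub>i)\<close>.\<close>

definition opp :: "nat \<Rightarrow> nat \<Rightarrow> profile \<Rightarrow> profile" where
  "opp n i s = restrict s (players n - {i})"

definition join :: "nat \<Rightarrow> nat \<Rightarrow> profile \<Rightarrow> profile" where
  "join i x t = t(i := x)"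

lemma join_mem_profiles:
  assumes "i \<in> players n" "x \<in> strategies k i" "t \<in> opp_profiles n k i"
  shows "join i x t \<in> profiles n k"
  using assms by (auto simp: join_def profiles_def opp_profiles_def PiE_def extensional_def)

lemma opp_mem_opp_profiles:
  assumes "s \<in> profiles n k"
  shows "opp n i s \<in> opp_profiles n k i"
  using assms by (auto simp: opp_def profiles_def opp_profiles_def)

lemma join_opp:
  assumes "s \<in> profiles n k" "i \<in> players n"
  shows "join i (s i) (opp n i s) = s"
  using assms by (auto simp: join_def opp_def profiles_def PiE_def extensional_def fun_eq_iff)

definition coset_weighted_potential_game ::
  "nat \<Rightarrow> (nat \<Rightarrow> nat) \<Rightarrow> (nat \<Rightarrow> profile \<Rightarrow> real) \<Rightarrow> (nat \<Rightarrow> profile \<Rightarrow> real) \<Rightarrow> bool" where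
  "coset_weighted_potential_game n k c w \<longleftrightarrow>
     (\<forall>i\<in>players n. \<forall>t\<in>opp_profiles n k i. w i t > 0) \<and>
     (\<exists>P :: profile \<Rightarrow> real. \<forall>i\<in>players n. \<forall>x\<in>strategies k i. \<forall>y\<in>strategies k i.
        \<forall>t\<in>opp_profiles n k i.
          c i (join i x t) - c i (join i y t) = w i t * (P (join i x t) - P (join i y t)))"

definition pure_nash_equilibrium ::
  "nat \<Rightarrow> (nat \<Rightarrow> nat) \<Rightarrow> (nat \<Rightarrow> profile \<Rightarrow> real) \<Rightarrow> profile \<Rightarrow> bool" where
  "pure_nash_equilibrium n k c s \<longleftrightarrow>
     s \<in> profiles n k \<and>
     (\<forall>i\<in>players n. \<forall>x\<in>strategies k i. c i s \<ge> c i (join i x (opp n i s)))"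

end

theory Submission
  imports Defs
begin

text \<open>The profile set is finite and nonempty, so \<open>P\<close> attains its maximum at some
  \<open>s\<close>. The weights may vary with the opponents' profile, but a deviation by
  \<open>i\<close> leaves that profile fixed, so payoff gain and potential gain have the same
  sign.\<close>

text \<open>
  Any global maximiser of the potential is an equilibrium: a unilateral deviation changes the
  deviator's payoff by a positive multiple of the change of the potential.
\<close>

theorem proposition12:
  fixes n :: nat
    and k :: "nat \<Rightarrow> nat"
    and c w :: "nat \<Rightarrow> profile \<Rightarrow> real"
  assumes "finite_game n k"
    and "coset_weighted_potential_game n k c w"
  shows "\<exists>s. pure_nash_equilibrium n k c s"
proof -
  have fin: "finite (profiles n k)"
    unfolding profiles_def players_def strategies_def by (intro finite_PiE) auto
  \<comment> \<open>This covers \<open>n = 0\<close> as well: the empty product has exactly one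
    element.\<close>
  have nonempty: "profiles n k \<noteq> {}"
    using assms(1) by (simp add: profiles_def finite_game_def PiE_eq_empty_iff)
  from assms(2) obtain P :: "profile \<Rightarrow> real"
    where w_pos: "\<And>i t. i \<in> players n \<Longrightarrow> t \<in> opp_profiles n k i \<Longrightarrow> w i t > 0"
      and P: "\<And>i x y t. i \<in> players n \<Longrightarrow> x \<in> strategies k i \<Longrightarrow> y \<in> strategies k i \<Longrightarrow>
        t \<in> opp_profiles n k i \<Longrightarrow>
        c i (join i x t) - c i (join i y t) = w i t * (P (join i x t) - P (join i y t))"
    unfolding coset_weighted_potential_game_def by blast
  have "Max (P ` profiles n k) \<in> P ` profiles n k"
    using fin nonempty by (intro Max_in) auto
  then obtain s where s: "s \<in> profiles n k" and "P s = Max (P ` profiles n k)"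
    by auto
  then have s_max: "P s' \<le> P s" if "s' \<in> profiles n k" for s'
    using fin that by simp
  have "c i (join i x (opp n i s)) \<le> c i s" if i: "i \<in> players n" and x: "x \<in> strategies k i" for i x
  proof -
    let ?t = "opp n i s"
    have t: "?t \<in> opp_profiles n k i"
      using s by (rule opp_mem_opp_profiles)
    have si: "s i \<in> strategies k i"
      using s i by (auto simp: profiles_def)
    have "P (join i x ?t) \<le> P s"
      using join_mem_profiles[OF i x t] by (rule s_max)
    then have "w i ?t * (P (join i x ?t) - P s) \<le> 0"
      using w_pos[OF i t] by (simp add: mult_le_0_iff)
    \<comment> \<open>The potential identity with \<open>y = s i\<close>, where
      \<open>join_opp\<close> reassembles \<open>s\<close> from \<open>s i\<close> and
      \<open>?t\<close>.\<close>
    moreover have "c i (join i x ?t) - c i s = w i ?t * (P (join i x ?t) - P s)"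
      using P[OF i x si t] by (simp add: join_opp[OF s i])
    ultimately show ?thesis by simp
  qed
  with s show ?thesis
    unfolding pure_nash_equilibrium_def by blast
qed

end
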